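(* For all sufficiently large $k$, $$\frac{k^5}{2^{13}\cdot 10^{39}}\leq AW(k;3),$$ and $AW(k;3)\leq \frac{k^5}{120}(1+o(1))$ as $k\to\infty$.
   Context: A sequence of positive integers $w_1<\dots<w_n$ is an ascending wave if $w_{i+1}-w_i \geq w_i-w_{i-1}$ for $2\le i\le n-1$. For positive integers $k,r$, $AW(k;r)$ denotes the least positive integer $N$ such that every $r$-coloring of $\{1,\dots,N\}$ contains a $k$-term monochromatic ascending wave. *)

theory Defs
  imports Complex_Main
begin

definition ascending_wave :: "nat list \<Rightarrow> bool" where
  "ascending_wave w \<longleftrightarrow>
     (\<forall>x\<in>set w. 0 < x) \<and> sorted_wrt (<) w \<and>
     (\<forall>i. 1 \<le> i \<and> i + 1 < length w \<longrightarrow> w ! (i + 1) - w ! i \<ge> w ! i - w ! (i - 1))"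

definition AW_prop :: "nat \<Rightarrow> nat \<Rightarrow> nat \<Rightarrow> bool" where
  "AW_prop k r N \<longleftrightarrow>
     (\<forall>c :: nat \<Rightarrow> nat. (\<forall>x\<in>{1..N}. c x < r) \<longrightarrow>
        (\<exists>w. length w = k \<and> ascending_wave w \<and> set w \<subseteq> {1..N} \<and>
             (\<exists>col. \<forall>x\<in>set w. c x = col)))"

definition AW :: "nat \<Rightarrow> nat \<Rightarrow> nat" where
  "AW k r = (LEAST N. 0 < N \<and> AW_prop k r N)"

end

theory Submission
  imports Defs "HOL-Library.FuncSet" "HOL-Real_Asymp.Real_Asymp"
begin

text \<open>
  Upper bound. Keep one wave in each colour, all ending close together, with last differences at most
  D. Jump by D and wait for the shortest window in which every colour occurs; it extends all the waves
  at once. Before that window a colour is missing, so a wait of length about m^3 / 6 already contains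
  an m-term wave in one of the other two colours (by the same argument for two colours). Hence if t
  steps remain to a k-term wave, then the last wait, which enters each of the remaining differences,
  was at most about (k - t)^3 / 6, and the total length is at most the sum of t (k - t)^3 / 6, which
  is about k^5 / 120.

  Lower bound. Colour in two scales. Blocks of length about k^3 each omit one colour; inside a block
  the two other colours are constant on small blocks of length about k. Which symbol a block carries
  is random, but every symbol occurs in each group of six blocks, so a wave whose differences are
  below the block length at some scale stays within boundedly many blocks. A wave whose differences
  exceed the block length, in too short an interval, has differences that are almost constant over
  most stretches of 100 terms. It is then described, up to an error of one block, by few parameters,
  while it has to avoid a symbol in very many independently chosen groups; the union bound excludes
  all such waves simultaneously.
\<close>

section \<open>The upper bound\<close>

text \<open>The parameter \<open>d\<close> only bounds the last difference from above, and the next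
  term must lie at least \<open>d\<close> further on. Waves of different colours can thus share one
  bound; a one-term wave accepts every \<open>d\<close>.\<close>

inductive wave_to :: "nat set \<Rightarrow> nat \<Rightarrow> nat \<Rightarrow> nat \<Rightarrow> bool" for A where
  single: "x \<in> A \<Longrightarrow> wave_to A (Suc 0) x d"
| snoc: "wave_to A n x d \<Longrightarrow> y \<in> A \<Longrightarrow> x < y \<Longrightarrow> x + d \<le> y \<Longrightarrow> y - x \<le> e
    \<Longrightarrow> wave_to A (Suc n) y e"

lemma wave_to_mem: "wave_to A n x d \<Longrightarrow> x \<in> A"
  by (induction rule: wave_to.induct) auto

lemma wave_to_mono: "wave_to A n x d \<Longrightarrow> A \<subseteq> B \<Longrightarrow> wave_to B n x d"
  by (induction rule: wave_to.induct) (auto intro: wave_to.intros)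

lemma wave_to_shorten:
  "wave_to A n x d \<Longrightarrow> 1 \<le> m \<Longrightarrow> m \<le> n \<Longrightarrow> wave_to A m x d"
proof (induction arbitrary: m rule: wave_to.induct)
  case (single x d)
  then show ?case by (auto intro: wave_to.single simp: le_Suc_eq)
next
  case (snoc n x d y e)
  show ?case
  proof (cases "m = 1")
    case True
    then show ?thesis using snoc by (auto intro: wave_to.single)
  next
    case False
    then obtain m' where "m = Suc m'" "1 \<le> m'"
      using snoc.prems by (cases m) auto
    then show ?thesis
      using snoc by (auto intro!: wave_to.snoc[where x = x and d = d])
  qed
qed

text \<open>Pushing the endpoint to the right only enlarges the last difference, so the wave
  condition survives. As all of \<open>A\<close> lies at or after \<open>s\<close>, the new last
  difference is at most \<open>z - s\<close>.\<close>

lemma wave_to_replace_last: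
  assumes "wave_to A n y d" "A \<subseteq> B" "y \<le> z" "z \<in> B" "\<forall>v\<in>A. s \<le> v" "z - s \<le> e"
  shows "wave_to B n z e"
  using assms(1)
proof cases
  case single
  then show ?thesis using assms by (auto intro: wave_to.single)
next
  case (snoc n' x d')
  have "s \<le> x" using assms(5) wave_to_mem[OF snoc(2)] by auto
  then show ?thesis unfolding snoc(1)
    using snoc assms by (intro wave_to.snoc[where x = x and d = d'] wave_to_mono[OF snoc(2)]) auto
qed

lemma wave_to_list:
  assumes "wave_to A n x d" "\<forall>a\<in>A. 0 < a"
  shows "\<exists>w. length w = n \<and> set w \<subseteq> A \<and> ascending_wave w \<and> w \<noteq> [] \<and> last w = x
           \<and> (2 \<le> n \<longrightarrow> x - w ! (n - 2) \<le> d)"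
  using assms(1)
proof (induction rule: wave_to.induct)
  case (single x d)
  then show ?case using assms(2)
    by (intro exI[of _ "[x]"]) (auto simp: ascending_wave_def)
next
  case (snoc n x d y e)
  then obtain w where w: "length w = n" "set w \<subseteq> A" "ascending_wave w" "w \<noteq> []" "last w = x"
    "2 \<le> n \<longrightarrow> x - w ! (n - 2) \<le> d" by blast
  have sw: "sorted_wrt (<) w" using w(3) by (simp add: ascending_wave_def)
  have last: "w ! (n - 1) = x" using w by (simp add: last_conv_nth)
  have le: "v < y" if v: "v \<in> set w" for v
  proof -
    obtain i where i: "i < n" "v = w ! i" using v w(1) by (auto simp: in_set_conv_nth)
    have "w ! i \<le> w ! (n - 1)"
    proof (cases "i = n - 1")
      case False
      then show ?thesis using sw i w(1) by (intro less_imp_le) (auto simp: sorted_wrt_iff_nth_less)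
    qed simp
    then show ?thesis using i last snoc by auto
  qed
  have "ascending_wave (w @ [y])"
    unfolding ascending_wave_def
  proof (intro conjI allI impI)
    show "\<forall>x\<in>set (w @ [y]). 0 < x"
      using w assms(2) snoc by auto
    show "sorted_wrt (<) (w @ [y])"
      using sw le by (simp add: sorted_wrt_append)
    fix i assume i: "1 \<le> i \<and> i + 1 < length (w @ [y])"
    show "(w @ [y]) ! i - (w @ [y]) ! (i - 1) \<le> (w @ [y]) ! (i + 1) - (w @ [y]) ! i"
    proof (cases "i + 1 < n")
      case True
      then show ?thesis using w i by (auto simp: nth_append ascending_wave_def)
    next
      case False
      \<comment> \<open>The only new triple: the last difference of \<open>w\<close> is at most
        \<open>d\<close>, and \<open>y - x\<close> is at least \<open>d\<close>.\<close>
      then have i': "i = n - 1" "2 \<le> n" using i w by auto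
      then have "x - w ! (n - 2) \<le> d" using w by auto
      then show ?thesis using i' w(1) last snoc
        by (auto simp: nth_append numeral_2_eq_2)
    qed
  qed
  then show ?case using w snoc last
    by (intro exI[of _ "w @ [y]"]) (auto simp: nth_append)
qed

section \<open>Interval lengths that force waves, by number of colours\<close>

text \<open>Only the number of colours that occur in the interval matters, so the property applies
  to any subinterval from which a colour is missing.\<close>

definition forces_waves :: "nat \<Rightarrow> (nat \<Rightarrow> nat) \<Rightarrow> bool" where
  "forces_waves j F \<longleftrightarrow> (\<forall>(c :: nat \<Rightarrow> nat) s t m. card (c ` {s..<t}) \<le> j \<longrightarrow> 1 \<le> m \<longrightarrow> s + F m \<le> t \<longrightarrow>
     (\<exists>a x d. wave_to {y \<in> {s..<t}. c y = a} m x d))"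

lemma forces_wavesD:
  fixes c :: "nat \<Rightarrow> nat"
  assumes "forces_waves j F" "card (c ` {s..<t}) \<le> j" "1 \<le> m" "s + F m \<le> t"
  shows "\<exists>a x d. wave_to {y \<in> {s..<t}. c y = a} m x d"
  using assms unfolding forces_waves_def by blast

lemma forces_waves_mono:
  assumes "forces_waves j F" "\<And>m. 1 \<le> m \<Longrightarrow> F m \<le> F' m"
  shows "forces_waves j F'"
  unfolding forces_waves_def
proof (intro allI impI)
  fix c :: "nat \<Rightarrow> nat" and s t m :: nat
  assume "card (c ` {s..<t}) \<le> j" "1 \<le> m" "s + F' m \<le> t"
  moreover have "s + F m \<le> t" using assms(2)[of m] calculation by linarith
  ultimately show "\<exists>a x d. wave_to {y \<in> {s..<t}. c y = a} m x d"
    using forces_wavesD[OF assms(1)] by blast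
qed

text \<open>Vacuous, since an interval of positive length shows some colour. It supplies
  \<open>G\<close> when two colours are treated.\<close>

lemma forces_waves_0: "forces_waves 0 (\<lambda>_. 1)"
  by (auto simp: forces_waves_def)

lemma forces_waves_1: "forces_waves 1 (\<lambda>m. m)"
  unfolding forces_waves_def
proof (intro allI impI)
  fix c :: "nat \<Rightarrow> nat" and s t m :: nat
  assume *: "card (c ` {s..<t}) \<le> 1" "1 \<le> m" "s + m \<le> t"
  have eq: "c y = c s" if "y \<in> {s..<t}" for y
  proof -
    have "s \<in> {s..<t}" using that by auto
    moreover have "\<forall>u\<in>c ` {s..<t}. \<forall>v\<in>c ` {s..<t}. u = v"
      using *(1) unfolding One_nat_def by (rule card_le_Suc0_iff_eq[THEN iffD1, rotated]) simp
    ultimately show ?thesis using that by blast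
  qed
  have "wave_to {y \<in> {s..<t}. c y = c s} n (s + n - 1) 1" if "1 \<le> n" "n \<le> m" for n
    using that
  proof (induction n rule: dec_induct)
    case base
    then show ?case using * by (auto intro: wave_to.single)
  next
    case (step n)
    then show ?case using * eq[of "s + n"]
      by (intro wave_to.snoc[where x = "s + n - 1" and d = 1]) auto
  qed
  then show "\<exists>a x d. wave_to {y \<in> {s..<t}. c y = a} m x d"
    using * by blast
qed

text \<open>Trimming the shortest window that shows all colours leaves an interior missing the colours of
  both endpoints.\<close>

lemma rainbow_window:
  fixes c :: "nat \<Rightarrow> nat"
  assumes "C \<subseteq> c ` {s..<e}" "c ` {s..<e} \<subseteq> C" "card C = Suc (Suc j)"
  obtains t u where "s \<le> u" "u < t" "t < e" "C \<subseteq> c ` {u..t}"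
    "card (c ` {s..<t}) \<le> Suc j" "card (c ` {Suc u..<t}) \<le> j"
proof -
  have finC: "finite C" using assms(3) card.infinite by fastforce
  have "C \<noteq> {}" using assms(3) by auto
  then have "s < e" using assms(1) by (cases "s < e") auto
  then have ex: "C \<subseteq> c ` {s..e - 1}"
    using assms(1) by (auto simp: image_iff subset_iff) (metis One_nat_def Suc_pred atLeastLessThan_iff le_simps(2) not_gr_zero not_less_zero atLeastAtMost_iff)
  \<comment> \<open>By minimality \<open>c t\<close> does not occur on \<open>{s..<t}\<close>; by
    maximality of \<open>u\<close> below, \<open>c u\<close> does not recur up to
    \<open>t\<close>.\<close>
  define t where "t = (LEAST t. C \<subseteq> c ` {s..t})"
  have t: "C \<subseteq> c ` {s..t}" unfolding t_def using ex by (rule LeastI)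
  have te: "t < e" using Least_le[of "\<lambda>t. C \<subseteq> c ` {s..t}", OF ex] \<open>s < e\<close> unfolding t_def by linarith
  have tmin: "\<not> C \<subseteq> c ` {s..<t}"
  proof
    assume *: "C \<subseteq> c ` {s..<t}"
    then have "s < t" using \<open>C \<noteq> {}\<close> by (cases "s < t") auto
    then have "{s..<t} = {s..t - 1}" by auto
    then have "t \<le> t - 1" using * unfolding t_def by (intro Least_le) simp
    then show False using \<open>s < t\<close> by simp
  qed
  define u where "u = (GREATEST u. u \<le> t \<and> C \<subseteq> c ` {u..t})"
  have st: "s \<le> t" using t \<open>C \<noteq> {}\<close> by (cases "s \<le> t") auto
  have u: "u \<le> t" "C \<subseteq> c ` {u..t}"
    using GreatestI_nat[of "\<lambda>u. u \<le> t \<and> C \<subseteq> c ` {u..t}" s t] t st unfolding u_def by auto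
  have su: "s \<le> u"
    using Greatest_le_nat[of "\<lambda>u. u \<le> t \<and> C \<subseteq> c ` {u..t}" s t] t st unfolding u_def by auto
  have "\<not> (Suc u \<le> t \<and> C \<subseteq> c ` {Suc u..t})"
    using Greatest_le_nat[of "\<lambda>u. u \<le> t \<and> C \<subseteq> c ` {u..t}" "Suc u" t] unfolding u_def by auto
  \<comment> \<open>\<open>C\<close> has at least two colours, so the window is not a single
    point.\<close>
  moreover have "u \<noteq> t"
  proof
    assume "u = t"
    then have "card C \<le> card {c t}" using u by (intro card_mono) auto
    then show False using assms(3) by simp
  qed
  ultimately have ut: "u < t" and umin: "\<not> C \<subseteq> c ` {Suc u..t}" using u by auto
  have cu: "c u \<notin> c ` {Suc u..t}"
  proof
    assume "c u \<in> c ` {Suc u..t}"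
    moreover have "{u..t} = insert u {Suc u..t}" using ut by auto
    ultimately show False using umin u(2) by (simp add: insert_absorb)
  qed
  have ct: "c t \<notin> c ` {s..<t}"
  proof
    assume "c t \<in> c ` {s..<t}"
    moreover have "{s..t} = insert t {s..<t}" using st by auto
    ultimately show False using tmin t by (simp add: insert_absorb)
  qed
  have inC: "c v \<in> C" if "s \<le> v" "v < e" for v using assms(2) that by auto
  have "c ` {s..<t} \<subseteq> C - {c t}" proof safe
    fix v assume "v \<in> {s..<t}" "c v = c t"
    then show False using ct by (metis imageI)
  qed (use inC te in auto)
  then have "card (c ` {s..<t}) \<le> card (C - {c t})" using finC by (intro card_mono) auto
  also have "\<dots> = Suc j" using inC[of t] st te assms(3) by simp
  finally have 1: "card (c ` {s..<t}) \<le> Suc j" .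
  have "c ` {Suc u..<t} \<subseteq> C - {c t} - {c u}"
  proof safe
    fix v assume v: "v \<in> {Suc u..<t}"
    show "c v = c t \<Longrightarrow> False" using ct v su by (metis atLeastLessThan_iff imageI le_trans le_SucI Suc_leD)
    show "c v = c u \<Longrightarrow> False" using cu v by (metis atLeastAtMost_iff atLeastLessThan_iff imageI less_imp_le)
  qed (use inC su te in auto)
  then have "card (c ` {Suc u..<t}) \<le> card (C - {c t} - {c u})" using finC by (intro card_mono) auto
  also have "\<dots> = j"
  proof -
    have "c u \<noteq> c t" using ct su ut by (metis atLeastLessThan_iff imageI)
    then show ?thesis using inC[of t] inC[of u] st te su ut assms(3) by simp
  qed
  finally have 2: "card (c ` {Suc u..<t}) \<le> j" .
  show ?thesis using that su ut te u(2) 1 2 by blast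
qed

text \<open>Invariant: every wave begun so far ends within \<open>G k\<close> before
  \<open>p\<close> with last difference at most \<open>D\<close>, and some colour needs at most
  \<open>q\<close> more terms. A wait after which \<open>i\<close> steps remain is charged
  \<open>i + 1\<close> times in the sum: once to the position and once, through \<open>D\<close>, to
  each remaining difference.\<close>

lemma forces_waves_step:
  fixes c :: "nat \<Rightarrow> nat" and b e :: nat
  defines "W \<equiv> \<lambda>a. {y \<in> {b..<e}. c y = a}"
  assumes F: "forces_waves (Suc j) F" "mono F" and G: "forces_waves j G"
    and C: "c ` {b..<e} = C" "card C = Suc (Suc j)" and k: "1 \<le> k"
    and state: "\<forall>a\<in>C. n a = 0 \<or> (wave_to (W a) (n a) (x a) D \<and> p \<le> x a + G k \<and> x a \<le> p)"
      "\<exists>a\<in>C. k \<le> n a + q" "b \<le> p"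
    and room: "p + q * D + (\<Sum>i<q. (i + 1) * (F (k - i + 1) + 2 * G k + 1)) < e"
  shows "\<exists>a x d. wave_to (W a) k x d"
  using state room
proof (induction q arbitrary: n x D p rule: less_induct)
  case (less q)
  let ?E = "\<lambda>i. F (k - i + 1) + 2 * G k + 1"
  let ?S = "\<lambda>q. \<Sum>i<q. (i + 1) * ?E i"
  have sub: "wave_to (W a) m z d" if "wave_to {y \<in> {s..<t}. c y = a} m z d" "b \<le> s" "t \<le> e" for a m z d s t
    by (rule wave_to_mono[OF that(1)]) (use that in \<open>auto simp: W_def\<close>)
  show ?case
  proof (cases "q = 0")
    case True
    then obtain a where "a \<in> C" "k \<le> n a" using less.prems by auto
    then show ?thesis using less.prems(1) k wave_to_shorten by fastforce
  next
    case False
    define s where "s = p + D + 1"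
    have "?E 0 \<le> ?S q"
      using False sum_mono2[of "{..<q}" "{0}" "\<lambda>i. (i + 1) * ?E i"] by simp
    moreover have "D \<le> q * D" using False by simp
    moreover have "F k \<le> F (k - 0 + 1)" by (rule monoD[OF F(2)]) simp
    ultimately have sF: "s + F k \<le> e" using less.prems(4) unfolding s_def by linarith
    have bs: "b \<le> s" using less.prems by (simp add: s_def)
    show ?thesis
    proof (cases "C \<subseteq> c ` {s..<e}")
      case False
      \<comment> \<open>Some colour never returns, and at least \<open>F k\<close> points remain for
        the others.\<close>
      have "c ` {s..<e} \<subset> C" using False C(1) bs by auto
      then have "card (c ` {s..<e}) \<le> Suc j" using C
        by (metis finite_imageI finite_atLeastLessThan psubset_card_mono less_Suc_eq_le)
      then show ?thesis using forces_wavesD[OF F(1) _ k sF] sub[OF _ bs order_refl] by blast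
    next
      case True
      then obtain t u where tu: "s \<le> u" "u < t" "t < e" "C \<subseteq> c ` {u..t}"
        "card (c ` {s..<t}) \<le> Suc j" "card (c ` {Suc u..<t}) \<le> j"
        by (rule rainbow_window[of C c s e j]) (use C bs in auto)
      show ?thesis
      \<comment> \<open>A window interior of length \<open>G k\<close>, or a wait of length
        \<open>F k\<close>, already contains a \<open>k\<close>-term wave.\<close>
      proof (cases "Suc u + G k \<le> t \<or> s + F k \<le> t")
        case True
        then show ?thesis
        proof
          assume "Suc u + G k \<le> t"
          moreover have "b \<le> Suc u" "t \<le> e" using bs tu by auto
          ultimately show ?thesis using forces_wavesD[OF G tu(6) k] sub[of "Suc u" t] by blast
        next
          assume "s + F k \<le> t"
          moreover have "t \<le> e" using tu by auto
          ultimately show ?thesis using forces_wavesD[OF F(1) tu(5) k] sub[OF _ bs] by blast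
        qed
      next
        case False
        \<comment> \<open>\<open>D'\<close> bounds every new difference: \<open>y a\<close> is at
          most \<open>t\<close>, \<open>x a\<close> is at least \<open>p - G k\<close>, and
          \<open>s = p + D + 1\<close>.\<close>
        define D' where "D' = D + 1 + (t - s) + G k"
        have "\<forall>a\<in>C. \<exists>y. u \<le> y \<and> y \<le> t \<and> c y = a" using tu(4) by (force simp: subset_iff image_iff)
        then obtain y where y: "\<And>a. a \<in> C \<Longrightarrow> u \<le> y a \<and> y a \<le> t \<and> c (y a) = a" by metis
        have yW: "y a \<in> W a" if "a \<in> C" for a
          using y[OF that] tu bs by (auto simp: W_def)
        have ext: "wave_to (W a) (Suc (n a)) (y a) D'" if a: "a \<in> C" for a
        proof (cases "n a = 0")
          case True
          then show ?thesis using yW[OF a] by (auto intro: wave_to.single)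
        next
          case False
          then have "wave_to (W a) (n a) (x a) D" "p \<le> x a + G k" "x a \<le> p"
            using less.prems(1) a by auto
          then show ?thesis
            using y[OF a] yW[OF a] tu unfolding D'_def s_def
            by (intro wave_to.snoc[where x = "x a" and d = D]) auto
        qed
        have near: "t \<le> y a + G k \<and> y a \<le> t" if "a \<in> C" for a
          using y[OF that] False by auto
        \<comment> \<open>The wait enters \<open>t\<close> once and \<open>D'\<close> in each of
          \<open>q'\<close> later differences; these \<open>q' + 1\<close> copies are paid for by
          the summand with index \<open>q'\<close>.\<close>
        have D'_room: "t + q' * D' + ?S q' < e" if "q' < q" "t - s < F (k - q' + 1) + G k" for q'
        proof -
          have "t \<le> p + D + ?E q'" "D' \<le> D + ?E q'" using that tu unfolding s_def D'_def by linarith+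
          then have "t + q' * D' + ?S q' \<le> (p + D + ?E q') + q' * (D + ?E q') + ?S q'"
            by (intro add_mono mult_le_mono) auto
          also have "\<dots> = p + Suc q' * D + ?S (Suc q')" by (simp add: algebra_simps)
          also have "\<dots> \<le> p + q * D + ?S q"
            using that by (intro add_mono mult_le_mono sum_mono2) auto
          finally show ?thesis using less.prems(4) by linarith
        qed
        \<comment> \<open>\<open>m\<close> measures the wait: \<open>t - s\<close> is below
          \<open>F (Suc m) + G k\<close>, but if \<open>m\<close> is positive it is at least
          \<open>F m + G k\<close>.\<close>
        define m where "m = (LEAST m. t - s < F (Suc m) + G k)"
        have exm: "t - s < F (Suc (k - 1)) + G k" 
        proof -
          have "t < s + F k" using False by linarith
          then show ?thesis using k tu by (simp add: less_diff_conv2)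
        qed
        then have m: "t - s < F (Suc m) + G k" unfolding m_def by (rule LeastI)
        have mk: "m \<le> k - 1" unfolding m_def using exm by (rule Least_le)
        show ?thesis
        proof (cases "m \<le> k - (q - 1)")
          case True
          \<comment> \<open>The wait is within the allowance for \<open>q - 1\<close> remaining
            steps, so all waves are simply extended.\<close>
          have "F (Suc m) \<le> F (k - (q - 1) + 1)" using True by (intro monoD[OF F(2)]) simp
          then have "t - s < F (k - (q - 1) + 1) + G k" using m by linarith
          then have r: "t + (q - 1) * D' + ?S (q - 1) < e" using D'_room[of "q - 1"] \<open>q \<noteq> 0\<close> by simp
          have "\<exists>a\<in>C. k \<le> Suc (n a) + (q - 1)" using less.prems(2) \<open>q \<noteq> 0\<close> by force
          then show ?thesis
            using ext near tu bs \<open>q \<noteq> 0\<close> r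
            by (intro less.IH[where y = "q - 1" and p = t and D = D' and x = y and n = "\<lambda>a. Suc (n a)"]) auto
        next
          case False
          \<comment> \<open>The wait is so long that it contains an \<open>m\<close>-term wave of
            its own. Adopting that wave leaves only \<open>k - m\<close> steps, fewer than
            \<open>q\<close>.\<close>
          define q' where "q' = k - m"
          have q': "q' < q" "k - q' = m" "0 < m" "k \<le> m + q'" using False mk k by (auto simp: q'_def)
          have "\<not> t - s < F (Suc (m - 1)) + G k"
            using q' not_less_Least[of "m - 1" "\<lambda>m. t - s < F (Suc m) + G k"] unfolding m_def by simp
          \<comment> \<open>The spare \<open>G k\<close> puts the end of the adopted wave before
            \<open>y a\<close>, to which its last term is then moved.\<close>
          then have Fm: "s + F m + G k \<le> t" using q'(3) tu by auto
          have "card (c ` {s..<s + F m}) \<le> card (c ` {s..<t})"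
            using Fm by (intro card_mono image_mono) auto
          then have "card (c ` {s..<s + F m}) \<le> Suc j" using tu by simp
          then obtain a z d where az: "wave_to {y \<in> {s..<s + F m}. c y = a} m z d"
            using forces_wavesD[OF F(1), of c s "s + F m" m] q' by auto
          have za: "s \<le> z" "z < s + F m" "c z = a" using wave_to_mem[OF az] by auto
          then have aC: "a \<in> C" using C(1) Fm tu bs by auto
          have w: "wave_to (W a) m (y a) D'"
            using az
            by (rule wave_to_replace_last[where s = s])
              (use Fm tu bs za near[OF aC] yW[OF aC] in \<open>auto simp: W_def D'_def\<close>)
          have r: "t + q' * D' + ?S q' < e" using D'_room[OF q'(1)] m q' by simp
          show ?thesis
            by (rule less.IH[where y = q' and p = t and D = D' and x = y and n = "(\<lambda>a. Suc (n a))(a := m)"])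
               (use ext near tu bs r w q' aC in \<open>auto intro: bexI[of _ a]\<close>)
        qed
      qed
    qed
  qed
qed

text \<open>The induction starts with no waves, \<open>D = 0\<close> and \<open>q = k\<close>; the
  leading 1 makes the room inequality strict.\<close>

lemma forces_waves_Suc_Suc:
  assumes F: "forces_waves (Suc j) F" "mono F" and G: "forces_waves j G"
  shows "forces_waves (Suc (Suc j)) (\<lambda>k. 1 + (\<Sum>i<k. (i + 1) * (F (k - i + 1) + 2 * G k + 1)))"
  unfolding forces_waves_def
proof (intro allI impI)
  fix c :: "nat \<Rightarrow> nat" and b e k :: nat
  assume *: "card (c ` {b..<e}) \<le> Suc (Suc j)" "1 \<le> k"
    "b + (1 + (\<Sum>i<k. (i + 1) * (F (k - i + 1) + 2 * G k + 1))) \<le> e"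
  let ?C = "c ` {b..<e}"
  show "\<exists>a x d. wave_to {y \<in> {b..<e}. c y = a} k x d"
  proof (cases "card ?C \<le> Suc j")
    case True
    have "F k \<le> F (k - 0 + 1)" by (rule monoD[OF F(2)]) simp
    also have "\<dots> \<le> (\<Sum>i<k. (i + 1) * (F (k - i + 1) + 2 * G k + 1))"
      using *(2) sum_mono2[of "{..<k}" "{0}" "\<lambda>i. (i + 1) * (F (k - i + 1) + 2 * G k + 1)"] by simp
    finally have "b + F k \<le> e" using *(3) by linarith
    then show ?thesis using forces_wavesD[OF F(1) True *(2)] by blast
  next
    case False
    have "b < e" using * by linarith
    then show ?thesis
      using *(3)
      by (intro forces_waves_step[OF F G refl _ *(2), where n = "\<lambda>_. 0" and D = 0 and p = b and q = k])
        (use * False in auto)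
  qed
qed

section \<open>Binomial estimates for two and three colours\<close>

lemma sum_choose_le: "(\<Sum>i<k. (k - i + a) choose r) \<le> (k + a + 1) choose (r + 1)"
proof (induction k)
  case (Suc k)
  have "(\<Sum>i<Suc k. (Suc k - i + a) choose r) = (Suc k + a choose r) + (\<Sum>i<k. (k - i + a) choose r)"
    by (simp only: sum.lessThan_Suc_shift) simp
  then show ?case using Suc by simp
qed simp

text \<open>The hockey-stick summation applied twice, the weight \<open>i + 1\<close> being a
  repeated sum. It turns m^3/6 into k^5/120.\<close>

lemma sum_Suc_mult_choose_le:
  "(\<Sum>i<k. (i + 1) * ((k - i + a) choose r)) \<le> (k + a + 2) choose (r + 2)"
proof (induction k)
  case (Suc k)
  have "(\<Sum>i<Suc k. (i + 1) * ((Suc k - i + a) choose r))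
      = (Suc k + a choose r) + (\<Sum>i<k. (i + 2) * ((k - i + a) choose r))"
    by (simp only: sum.lessThan_Suc_shift) simp
  also have "\<dots> = ((Suc k + a choose r) + (\<Sum>i<k. (k - i + a) choose r))
      + (\<Sum>i<k. (i + 1) * ((k - i + a) choose r))"
    by (simp add: sum.distrib algebra_simps)
  also have "\<dots> \<le> ((Suc k + a choose r) + (k + a + 1 choose (r + 1))) + (k + a + 2 choose (r + 2))"
    using sum_choose_le[of k a r] Suc by (intro add_mono) auto
  also have "\<dots> = (Suc k + a + 2) choose (r + 2)" by (simp add: numeral_2_eq_2)
  finally show ?case .
qed simp

lemma forces_waves_2: "forces_waves 2 (\<lambda>k. (k + 7) choose 3)"
proof -
  have "forces_waves (Suc (Suc 0)) (\<lambda>k. 1 + (\<Sum>i<k. (i + 1) * ((k - i + 1) + 2 * 1 + 1)))"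
    using forces_waves_Suc_Suc[of 0 "\<lambda>m. m" "\<lambda>_. 1"] forces_waves_0 forces_waves_1
    by (simp add: monoI)
  then have "forces_waves (Suc (Suc 0)) (\<lambda>k. (k + 7) choose 3)"
  proof (rule forces_waves_mono)
    fix k :: nat
    have "(\<Sum>i<k. (i + 1) * ((k - i + 1) + 2 * 1 + 1)) = (\<Sum>i<k. (i + 1) * ((k - i + 4) choose 1))"
    proof (intro sum.cong refl)
      fix i
      have "(k - i + 1) + 2 * 1 + 1 = (k - i + 4)" by simp
      then show "(i + 1) * ((k - i + 1) + 2 * 1 + 1) = (i + 1) * ((k - i + 4) choose 1)"
        by (simp only: choose_one)
    qed
    also have "\<dots> \<le> (k + 4 + 2) choose (1 + 2)" by (rule sum_Suc_mult_choose_le)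
    finally show "1 + (\<Sum>i<k. (i + 1) * ((k - i + 1) + 2 * 1 + 1)) \<le> (k + 7) choose 3"
      by (simp add: numeral_eq_Suc)
  qed
  then show ?thesis by (simp add: numeral_2_eq_2)
qed

text \<open>The binomial coefficient carries the main term; the contributions of
  \<open>2 * G k + 1\<close> add up to order k^3 only.\<close>

lemma forces_waves_3: "forces_waves 3 (\<lambda>k. 1 + ((k + 10) choose 5) + k * k * (2 * k + 1))"
proof -
  have "forces_waves (Suc (Suc 1)) (\<lambda>k. 1 + (\<Sum>i<k. (i + 1) * ((((k - i + 1) + 7) choose 3) + 2 * k + 1)))"
    using forces_waves_Suc_Suc[of 1 "\<lambda>k. (k + 7) choose 3" "\<lambda>k. k"] forces_waves_1 forces_waves_2
    by (simp add: numeral_2_eq_2 monoI binomial_right_mono)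
  then have "forces_waves (Suc (Suc 1)) (\<lambda>k. 1 + ((k + 10) choose 5) + k * k * (2 * k + 1))"
  proof (rule forces_waves_mono)
    fix k :: nat
    have "(\<Sum>i<k. (i + 1) * ((((k - i + 1) + 7) choose 3) + 2 * k + 1))
       = (\<Sum>i<k. (i + 1) * ((k - i + 8) choose 3)) + (\<Sum>i<k. (i + 1) * (2 * k + 1))"
      unfolding sum.distrib[symmetric]
    proof (intro sum.cong refl)
      fix i
      have "(k - i + 1) + 7 = k - i + 8" by simp
      then show "(i + 1) * ((((k - i + 1) + 7) choose 3) + 2 * k + 1)
          = (i + 1) * ((k - i + 8) choose 3) + (i + 1) * (2 * k + 1)"
        by (simp only: distrib_left add.assoc)
    qed
    also have "\<dots> \<le> ((k + 8 + 2) choose (3 + 2)) + (\<Sum>i<k. k * (2 * k + 1))"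
      by (intro add_mono sum_Suc_mult_choose_le sum_mono mult_le_mono) auto
    finally show "1 + (\<Sum>i<k. (i + 1) * ((((k - i + 1) + 7) choose 3) + 2 * k + 1))
        \<le> 1 + ((k + 10) choose 5) + k * k * (2 * k + 1)" by (simp add: algebra_simps)
  qed
  then show ?thesis by (simp add: numeral_3_eq_3)
qed

section \<open>Passing from forced waves to \<open>AW\<close>\<close>

lemma AW_prop_forces_waves:
  assumes "forces_waves r F" "1 \<le> k" "F k \<le> N"
  shows "AW_prop k r N"
  unfolding AW_prop_def
proof (intro allI impI)
  fix c :: "nat \<Rightarrow> nat" assume c: "\<forall>x\<in>{1..N}. c x < r"
  have "card (c ` {1..<N + 1}) \<le> card {..<r}" using c by (intro card_mono) auto
  then obtain a x d where "wave_to {y \<in> {1..<N + 1}. c y = a} k x d"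
    using forces_wavesD[OF assms(1), of c 1 "N + 1" k] assms by auto
  from wave_to_list[OF this] obtain w where "length w = k" "set w \<subseteq> {y \<in> {1..<N + 1}. c y = a}" "ascending_wave w"
    by auto
  then show "\<exists>w. length w = k \<and> ascending_wave w \<and> set w \<subseteq> {1..N} \<and> (\<exists>col. \<forall>x\<in>set w. c x = col)"
    by (intro exI[of _ w] conjI exI[of _ a]) auto
qed

lemma AW_le:
  assumes "forces_waves r F" "1 \<le> k" "0 < F k"
  shows "AW k r \<le> F k"
  unfolding AW_def using AW_prop_forces_waves[OF assms(1,2)] assms by (intro Least_le) auto

text \<open>\<open>LEAST\<close> needs a witness; \<open>Suc (F k)\<close> is one, and it is
  positive even if \<open>F k\<close> is 0.\<close>

lemma AW_prop_AW:
  assumes "forces_waves r F" "1 \<le> k"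
  shows "AW_prop k r (AW k r)"
proof -
  have "0 < Suc (F k) \<and> AW_prop k r (Suc (F k))" using AW_prop_forces_waves[OF assms] by simp
  from LeastI[of "\<lambda>N. 0 < N \<and> AW_prop k r N", OF this] show ?thesis unfolding AW_def by simp
qed

lemma AW_3_upper:
  "\<exists>g :: nat \<Rightarrow> real. g \<longlonglongrightarrow> 0 \<and>
     (\<forall>\<^sub>F k in sequentially. real (AW k 3) \<le> real k ^ 5 / 120 * (1 + g k))"
proof (intro exI conjI)
  \<comment> \<open>\<open>g\<close> is the relative excess of an explicit polynomial bound over
    k^5/120.\<close>
  define g :: "nat \<Rightarrow> real" where
    "g k = ((real k + 10) ^ 5 + 120 * (1 + real k * real k * (2 * real k + 1))) / real k ^ 5 - 1" for k
  show "g \<longlonglongrightarrow> 0" unfolding g_def by real_asymp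
  show "\<forall>\<^sub>F k in sequentially. real (AW k 3) \<le> real k ^ 5 / 120 * (1 + g k)"
    using eventually_ge_at_top[of 1]
  proof eventually_elim
    case (elim k)
    have "real ((k + 10) choose 5) * 120 = real (((k + 10) choose 5) * fact 5)"
      by (simp add: fact_numeral)
    also have "\<dots> \<le> real ((k + 10) ^ 5)"
      by (intro of_nat_mono binomial_fact_pow)
    finally have "real ((k + 10) choose 5) * 120 \<le> (real k + 10) ^ 5" by simp
    moreover have "AW k 3 \<le> 1 + ((k + 10) choose 5) + k * k * (2 * k + 1)"
      using AW_le[OF forces_waves_3 elim] by simp
    then have "real (AW k 3) \<le> real (1 + ((k + 10) choose 5) + k * k * (2 * k + 1))"
      by (rule of_nat_mono)
    ultimately have "real (AW k 3) * 120 \<le> (real k + 10) ^ 5 + 120 * (1 + real k * real k * (2 * real k + 1))"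
      by (simp add: algebra_simps)
    then have "real (AW k 3) \<le> real k ^ 5 / 120 *
        (((real k + 10) ^ 5 + 120 * (1 + real k * real k * (2 * real k + 1))) / real k ^ 5)"
      using elim by simp
    then show ?case by (simp add: g_def)
  qed
qed

section \<open>Random sequences of symbols\<close>

abbreviation rotations :: "nat \<Rightarrow> (nat \<Rightarrow> nat) set" where
  "rotations G \<equiv> {..<G} \<rightarrow>\<^sub>E {..<6}"

text \<open>The uniform distribution on independent rotations, one for each of \<open>G\<close>
  groups of six blocks.\<close>

definition pr :: "nat \<Rightarrow> ((nat \<Rightarrow> nat) \<Rightarrow> bool) \<Rightarrow> real" where
  "pr G P = real (card {f \<in> rotations G. P f}) / real (card (rotations G))"

lemma finite_rotations: "finite (rotations G)"
  by (intro finite_PiE) auto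

lemma card_rotations_pos: "0 < card (rotations G)"
  by (simp add: card_PiE)

lemma pr_nonneg: "0 \<le> pr G P"
  by (simp add: pr_def)

lemma pr_le_1: "pr G P \<le> 1"
proof -
  have "card {f \<in> rotations G. P f} \<le> card (rotations G)"
    using finite_rotations by (intro card_mono) auto
  then show ?thesis using card_rotations_pos[of G] by (simp add: pr_def)
qed

lemma pr_mono:
  assumes "\<And>f. f \<in> rotations G \<Longrightarrow> P f \<Longrightarrow> Q f"
  shows "pr G P \<le> pr G Q"
proof -
  have "card {f \<in> rotations G. P f} \<le> card {f \<in> rotations G. Q f}"
    using assms finite_rotations by (intro card_mono) auto
  then show ?thesis by (simp add: pr_def divide_right_mono)
qed

lemma pr_UN:
  assumes "finite I"
  shows "pr G (\<lambda>f. \<exists>i\<in>I. P i f) \<le> (\<Sum>i\<in>I. pr G (P i))"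
proof -
  have "{f \<in> rotations G. \<exists>i\<in>I. P i f} = (\<Union>i\<in>I. {f \<in> rotations G. P i f})" by auto
  then have "card {f \<in> rotations G. \<exists>i\<in>I. P i f} \<le> (\<Sum>i\<in>I. card {f \<in> rotations G. P i f})"
    using card_UN_le[OF assms] by metis
  then have "real (card {f \<in> rotations G. \<exists>i\<in>I. P i f}) \<le> (\<Sum>i\<in>I. real (card {f \<in> rotations G. P i f}))"
    unfolding of_nat_sum[symmetric] by (rule of_nat_mono)
  then show ?thesis unfolding pr_def sum_divide_distrib[symmetric] by (rule divide_right_mono) simp
qed

text \<open>Swapping the tails of two independent samples is an involution.\<close>

lemma pr_indep:
  assumes P: "\<And>f g. (\<forall>i<t. f i = g i) \<Longrightarrow> P f \<Longrightarrow> P g"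
    and Q: "\<And>f g. (\<forall>i\<ge>t. f i = g i) \<Longrightarrow> Q f \<Longrightarrow> Q g"
  shows "pr G (\<lambda>f. P f \<and> Q f) = pr G P * pr G Q"
proof -
  define Om where "Om = rotations G"
  define sp :: "(nat \<Rightarrow> nat) \<Rightarrow> (nat \<Rightarrow> nat) \<Rightarrow> nat \<Rightarrow> nat" where "sp f g = (\<lambda>i. if i < t then f i else g i)" for f g
  define \<Phi> where "\<Phi> = (\<lambda>(f, g). (sp f g, sp g f))"
  have sp: "sp f g \<in> Om" if "f \<in> Om" "g \<in> Om" for f g
    using that by (auto simp: Om_def sp_def PiE_iff extensional_def)
  have invol: "\<Phi> (\<Phi> z) = z" for z
    by (cases z) (auto simp: \<Phi>_def sp_def fun_eq_iff)
  have P': "P (sp f g)" if "P f" for f g by (rule P[OF _ that]) (simp add: sp_def)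
  have Q': "Q (sp f g)" if "Q g" for f g by (rule Q[OF _ that]) (simp add: sp_def)
  have "bij_betw \<Phi> ({f \<in> Om. P f \<and> Q f} \<times> Om) ({f \<in> Om. P f} \<times> {f \<in> Om. Q f})"
  proof (rule bij_betw_byWitness[where f' = \<Phi>])
    show "\<Phi> ` ({f \<in> Om. P f \<and> Q f} \<times> Om) \<subseteq> {f \<in> Om. P f} \<times> {f \<in> Om. Q f}"
      using sp P' Q' by (auto simp: \<Phi>_def)
    show "\<Phi> ` ({f \<in> Om. P f} \<times> {f \<in> Om. Q f}) \<subseteq> {f \<in> Om. P f \<and> Q f} \<times> Om"
      using sp P' Q' by (auto simp: \<Phi>_def)
  qed (use invol in auto)
  then have "card ({f \<in> Om. P f \<and> Q f} \<times> Om) = card ({f \<in> Om. P f} \<times> {f \<in> Om. Q f})"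
    by (rule bij_betw_same_card)
  then have "real (card {f \<in> Om. P f \<and> Q f}) * real (card Om) = real (card {f \<in> Om. P f}) * real (card {f \<in> Om. Q f})"
    unfolding card_cartesian_product of_nat_mult[symmetric] by (rule arg_cong)
  then show ?thesis using card_rotations_pos[of G] by (simp add: pr_def Om_def[symmetric] field_simps)
qed

text \<open>Each group of six blocks carries the word 001122, rotated by f. The repetitions make a whole
  window of two consecutive blocks carry the same symbol with positive probability.\<close>

definition symb :: "(nat \<Rightarrow> nat) \<Rightarrow> nat \<Rightarrow> nat" where
  "symb f y = ((y + f (y div 6)) mod 6) div 2"

lemma symb_less: "symb f y < 3"
  by (simp add: symb_def less_mult_imp_div_less)

text \<open>\<open>5 * v\<close> is -\<open>v\<close> modulo 6, so the rotation
  \<open>2 * a + 5 * v\<close> brings the first letter \<open>a\<close> of the word 001122 to place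
  \<open>v\<close>.\<close>

lemma mod_6_cancel: "(v + (2 * a + 5 * v) mod 6) mod 6 = (2 * a) mod 6" for v :: nat
  using mod_mult_self2[of "2 * a" 6 v] by (simp add: mod_add_right_eq)

lemma symb_in_group:
  assumes "a < 3"
  shows "\<exists>y. 6 * g \<le> y \<and> y < 6 * g + 6 \<and> symb f y = a"
proof (intro exI conjI)
  let ?r = "(2 * a + 5 * f g) mod 6"
  let ?y = "6 * g + ?r"
  show "6 * g \<le> ?y" "?y < 6 * g + 6" by auto
  have "(?y + f g) mod 6 = ((f g + ?r) + 6 * g) mod 6" by (simp only: ac_simps)
  also have "\<dots> = 2 * a" using assms by (simp only: mod_mult_self2 mod_6_cancel) simp
  finally show "symb f ?y = a" by (simp add: symb_def)
qed

section \<open>Blocks carrying a prescribed symbol\<close>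

text \<open>Blocks have length 200 here. A term known only to lie between \<open>v\<close> and
  \<open>v + 200\<close> falls into one of these two blocks, so a hit forces it onto symbol
  \<open>a\<close>.\<close>

definition hit :: "(nat \<Rightarrow> nat) \<Rightarrow> nat \<Rightarrow> nat \<Rightarrow> bool" where
  "hit f a v \<longleftrightarrow> symb f (v div 200) = a \<and> symb f (v div 200 + 1) = a"

lemma hit_cong:
  assumes "f (v div 1200) = g (v div 1200)" "f (v div 1200 + 1) = g (v div 1200 + 1)"
  shows "hit f a v \<longleftrightarrow> hit g a v"
proof -
  have 1: "v div 200 div 6 = v div 1200" by (simp add: div_mult2_eq[symmetric])
  have 2: "(v div 200 + 1) div 6 = v div 1200 \<or> (v div 200 + 1) div 6 = v div 1200 + 1"
    unfolding 1[symmetric] by linarith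
  show ?thesis using 2 assms unfolding hit_def symb_def 1 by auto
qed

lemma hitI:
  assumes "a < 3" "y = v div 200" "g = v div 1200"
    "f g = (2 * a + 5 * y) mod 6" "f (g + 1) = (2 * a + 5 * (y + 1)) mod 6"
  shows "hit f a v"
proof -
  have g: "y div 6 = g" using assms by (simp add: div_mult2_eq[symmetric])
  have a: "(v + (2 * a + 5 * v) mod 6) mod 6 = 2 * a" for v
    using assms(1) by (simp add: mod_6_cancel)
  have "symb f (y + 1) = a"
  proof (cases "(y + 1) div 6 = g")
    case True
    \<comment> \<open>Within the same group the next block carries the next letter of the word, the
      second copy of \<open>a\<close>.\<close>
    have "(1 + (y + f g)) mod 6 = (1 + (y + f g) mod 6) mod 6" by (simp only: mod_add_right_eq)
    also have "\<dots> = 2 * a + 1" unfolding assms(4) a using assms(1) by simp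
    finally have "((y + 1) + f g) mod 6 = 2 * a + 1" by simp
    then show ?thesis unfolding symb_def True by simp
  next
    case False
    then have "(y + 1) div 6 = g + 1" using g by linarith
    then show ?thesis unfolding symb_def using assms(5) a[of "y + 1"] by simp
  qed
  moreover have "symb f y = a" using g assms(4) a[of y] by (simp add: symb_def)
  ultimately show ?thesis using assms(2) by (simp add: hit_def)
qed

text \<open>Prescribing two rotations produces a hit. Recording the two overwritten values makes the
  overwriting injective, so hits fill at least 1/36 of the space.\<close>

lemma pr_not_hit:
  assumes "a < 3" "v div 1200 + 1 < G"
  shows "pr G (\<lambda>f. \<not> hit f a v) \<le> 35 / 36"
proof -
  define g where "g = v div 1200"
  define y where "y = v div 200"
  define r where "r = (2 * a + 5 * y) mod 6"
  define r' where "r' = (2 * a + 5 * (y + 1)) mod 6"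
  let ?O = "rotations G"
  let ?H = "{f \<in> ?O. hit f a v}"
  define \<Phi> where "\<Phi> f = ((f g, f (g + 1)), f(g := r, g + 1 := r'))" for f :: "nat \<Rightarrow> nat"
  have gG: "g + 1 < G" using assms by (simp add: g_def)
  have inj: "inj_on \<Phi> ?O"
  proof (rule inj_onI)
    fix f f' assume "\<Phi> f = \<Phi> f'"
    then have e: "f g = f' g" "f (g + 1) = f' (g + 1)" "f(g := r, g + 1 := r') = f'(g := r, g + 1 := r')"
      by (auto simp: \<Phi>_def)
    show "f = f'"
    proof
      fix i
      show "f i = f' i" using e(1,2) fun_cong[OF e(3), of i] by (cases "i = g"; cases "i = g + 1") auto
    qed
  qed
  have "\<Phi> ` ?O \<subseteq> ({..<6} \<times> {..<6}) \<times> ?H"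
  proof (rule image_subsetI)
    fix f assume f: "f \<in> ?O"
    let ?f = "f(g := r, g + 1 := r')"
    have "hit ?f a v" by (rule hitI[OF assms(1) y_def g_def]) (auto simp: r_def r'_def)
    moreover have "?f \<in> ?O" using f gG by (auto simp: PiE_iff extensional_def r_def r'_def)
    ultimately show "\<Phi> f \<in> ({..<6} \<times> {..<6}) \<times> ?H"
      using f gG by (auto simp: \<Phi>_def PiE_iff)
  qed
  then have "card (\<Phi> ` ?O) \<le> card (({..<6::nat} \<times> {..<6::nat}) \<times> ?H)"
    using finite_rotations[of G] by (intro card_mono) auto
  then have "card ?O \<le> 36 * card ?H" by (simp add: card_image[OF inj] card_cartesian_product)
  moreover have "card ?O = card ?H + card {f \<in> ?O. \<not> hit f a v}"
    using finite_rotations[of G] by (subst card_Un_disjoint[symmetric]) (auto intro: arg_cong[where f = card])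
  ultimately have "36 * card {f \<in> ?O. \<not> hit f a v} \<le> 35 * card ?O" by linarith
  then have "36 * real (card {f \<in> ?O. \<not> hit f a v}) \<le> 35 * real (card ?O)"
    using of_nat_mono[where ?'a = real] by fastforce
  then show ?thesis using card_rotations_pos[of G] by (simp add: pr_def field_simps)
qed

text \<open>Each query reads two consecutive groups of length 1200. Steps of at least 2400 make
  these pairs disjoint, hence the queries independent.\<close>

lemma pr_no_hits:
  assumes "a < 3" "2400 \<le> D" "(v + l * D) div 1200 \<le> G"
  shows "pr G (\<lambda>f. \<forall>i<l. \<not> hit f a (v + i * D)) \<le> (35 / 36) ^ l"
  using assms(3)
proof (induction l)
  case 0
  then show ?case by (simp add: pr_le_1)
next
  case (Suc l)
  have far: "(v + i * D) div 1200 + 2 \<le> (v + j * D) div 1200" if "i < j" for i j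
  proof -
    have "(i + 1) * D \<le> j * D" using that by (intro mult_le_mono1) simp
    then have "v + i * D + 2400 \<le> v + j * D" using assms(2) by (simp add: algebra_simps)
    then have "(v + i * D + 2400) div 1200 \<le> (v + j * D) div 1200" by (rule div_le_mono)
    then show ?thesis by simp
  qed
  have "pr G (\<lambda>f. \<forall>i<Suc l. \<not> hit f a (v + i * D))
      = pr G (\<lambda>f. (\<forall>i<l. \<not> hit f a (v + i * D)) \<and> \<not> hit f a (v + l * D))"
    by (simp add: less_Suc_eq all_conj_distrib conj_commute imp_disjL)
  also have "\<dots> = pr G (\<lambda>f. \<forall>i<l. \<not> hit f a (v + i * D)) * pr G (\<lambda>f. \<not> hit f a (v + l * D))"
  proof (rule pr_indep[where t = "(v + l * D) div 1200"])
    fix f g :: "nat \<Rightarrow> nat"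
    assume *: "\<forall>i<(v + l * D) div 1200. f i = g i" "\<forall>i<l. \<not> hit f a (v + i * D)"
    show "\<forall>i<l. \<not> hit g a (v + i * D)"
    proof (intro allI impI)
      fix i assume "i < l"
      then show "\<not> hit g a (v + i * D)"
        using * far[of i l] hit_cong[of f "v + i * D" g a] by auto
    qed
  next
    fix f g :: "nat \<Rightarrow> nat"
    assume "\<forall>i\<ge>(v + l * D) div 1200. f i = g i" "\<not> hit f a (v + l * D)"
    then show "\<not> hit g a (v + l * D)" using hit_cong[of f "v + l * D" g a] by auto
  qed
  also have "\<dots> \<le> (35 / 36) ^ l * (35 / 36)"
    using Suc far[of l "Suc l"] assms(1)
    by (intro mult_mono Suc.IH pr_not_hit pr_nonneg) auto
  finally show ?case by (simp add: mult.commute)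
qed

text \<open>A wave is read in segments of 100 terms. In units of h, a segment starts at about 100 X with
  difference about D; u is the growth of D over the segment and j the rounding error. If u = 0, the
  i-th term is known up to 200 units, one block length.\<close>

fun avoids :: "(nat \<Rightarrow> nat) \<Rightarrow> nat \<Rightarrow> nat \<Rightarrow> nat \<Rightarrow> nat \<Rightarrow> nat \<Rightarrow> nat \<Rightarrow> bool" where
  "avoids f a q 0 m X D = True"
| "avoids f a q (Suc n) m X D = (\<exists>u\<in>{..m}. \<exists>j\<in>{..u + 1}. X + D + j \<le> q \<and>
     (u = 0 \<longrightarrow> (\<forall>i<100. \<not> hit f a (100 * X + i * D))) \<and> avoids f a q n (m - u) (X + D + j) (D + u))"

text \<open>Position \<open>100 * X\<close> lies in group \<open>X div 12\<close>, and all later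
  queries lie at or after it.\<close>

lemma avoids_cong:
  "(\<forall>i\<ge>X div 12. f i = g i) \<Longrightarrow> avoids f a q n m X D \<Longrightarrow> avoids g a q n m X D"
proof (induction n arbitrary: m X D)
  case (Suc n)
  obtain u j where uj: "u \<in> {..m}" "j \<in> {..u + 1}" "X + D + j \<le> q"
    "u = 0 \<longrightarrow> (\<forall>i<100. \<not> hit f a (100 * X + i * D))" "avoids f a q n (m - u) (X + D + j) (D + u)"
    using Suc.prems(2) unfolding avoids.simps by (elim bexE conjE) (rule that; assumption)
  have "X div 12 \<le> (X + D + j) div 12" by (rule div_le_mono) simp
  then have 1: "avoids g a q n (m - u) (X + D + j) (D + u)"
    using Suc.prems(1) uj(5) by (intro Suc.IH) auto
  have "hit f a (100 * X + i * D) = hit g a (100 * X + i * D)" for i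
  proof -
    have "(100 * X) div 1200 \<le> (100 * X + i * D) div 1200" by (rule div_le_mono) simp
    moreover have "(100 * X) div 1200 = X div 12" by (simp add: div_mult_mult1[of 100 X 12, simplified])
    ultimately show ?thesis using Suc.prems(1) by (intro hit_cong) auto
  qed
  then have 2: "u = 0 \<longrightarrow> (\<forall>i<100. \<not> hit g a (100 * X + i * D))" using uj(4) by simp
  show ?case unfolding avoids.simps
    by (intro bexI[of _ u] bexI[of _ j] conjI uj(1-3) 1 2)
qed simp

text \<open>\<open>u + 2\<close> counts the rounding errors \<open>j\<close>, and 1/8 is the price
  of a segment without growth. The base 32 is large enough to leave a geometric series in
  \<open>u\<close> with sum at most half of \<open>32 ^ m\<close>.\<close>

lemma weight_le: "real (u + 2) * (if u = 0 then 1 / 8 else 1) * 32 ^ (m - u) \<le> 32 ^ m / 4 * (1 / 2) ^ u" if "u \<le> m"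
proof -
  have "(u + 2) * 4 * 2 ^ u \<le> (32::nat) ^ u" if "1 \<le> u" for u :: nat
    using that
  proof (induction u rule: dec_induct)
    case (step u)
    have "(Suc u + 2) * 4 * 2 ^ Suc u \<le> 32 * ((u + 2) * 4 * 2 ^ u)"
      using mult_right_mono[of "(u + 3) * 8" "32 * ((u + 2) * 4)" "2 ^ u :: nat"] by simp
    also have "\<dots> \<le> 32 * 32 ^ u" using step by simp
    finally show ?case by simp
  qed simp
  then have "real ((u + 2) * 4 * 2 ^ u) \<le> real (32 ^ u)" if "1 \<le> u" for u :: nat
    using that by (intro of_nat_mono)
  then have *: "real (u + 2) * 4 * 2 ^ u \<le> 32 ^ u" if "1 \<le> u" using that by simp
  have "real (u + 2) * (if u = 0 then 1 / 8 else 1) * 4 * 2 ^ u \<le> 32 ^ u"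
    using * by (cases "u = 0") auto
  then have "real (u + 2) * (if u = 0 then 1 / 8 else 1) * 4 * 2 ^ u * 32 ^ (m - u) \<le> 32 ^ u * 32 ^ (m - u)"
    by (intro mult_right_mono) auto
  also have "32 ^ u * 32 ^ (m - u) = (32::real) ^ m" using that by (simp add: power_add[symmetric])
  finally show ?thesis by (simp add: power_divide field_simps)
qed

text \<open>Every segment costs a factor 1/2. Either \<open>u = 0\<close>, and its 100 queries all
  miss with probability at most 1/8, independently of the later segments, or it consumes part of the
  growth budget \<open>m\<close>, paid for by \<open>32 ^ m\<close>.\<close>

lemma pr_avoids:
  assumes "a < 3"
  shows "2400 \<le> D \<Longrightarrow> pr (q + 2) (\<lambda>f. avoids f a q n m X D) \<le> 32 ^ m / 2 ^ n"
proof (induction n arbitrary: m X D)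
  case 0
  show ?case using order.trans[OF pr_le_1 one_le_power[of "32::real" m]] by simp
next
  case (Suc n)
  let ?pr = "pr (q + 2)"
  have summand: "?pr (\<lambda>f. X + D + j \<le> q \<and> (u = 0 \<longrightarrow> (\<forall>i<100. \<not> hit f a (100 * X + i * D)))
      \<and> avoids f a q n (m - u) (X + D + j) (D + u))
      \<le> (if u = 0 then 1 / 8 else 1) * (32 ^ (m - u) / 2 ^ n)" (is "pr _ ?A \<le> _") for u j
  proof -
    have IH: "?pr (\<lambda>f. avoids f a q n (m - u) (X + D + j) (D + u)) \<le> 32 ^ (m - u) / 2 ^ n"
      using Suc.prems by (intro Suc.IH) auto
    consider "q < X + D + j" | "u \<noteq> 0" | "X + D + j \<le> q" "u = 0" by linarith
    then show ?thesis
    proof cases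
      case 1
      then show ?thesis by (simp add: pr_def)
    next
      case 2
      have "?pr ?A \<le> ?pr (\<lambda>f. avoids f a q n (m - u) (X + D + j) (D + u))" by (rule pr_mono) auto
      then show ?thesis using IH 2 by simp
    next
      case 3
      have X: "(100 * X + 100 * D) div 1200 = (X + D) div 12"
        using div_mult_mult1[of 100 "X + D" 12] by simp
      have "?pr ?A = ?pr (\<lambda>f. (\<forall>i<100. \<not> hit f a (100 * X + i * D)) \<and> avoids f a q n (m - u) (X + D + j) (D + u))"
        using 3 by simp
      also have "\<dots> = ?pr (\<lambda>f. \<forall>i<100. \<not> hit f a (100 * X + i * D)) * ?pr (\<lambda>f. avoids f a q n (m - u) (X + D + j) (D + u))"
      \<comment> \<open>The last of the 100 queries lies at least 2400, two groups, before
        \<open>100 * (X + D)\<close>, where the later segments begin at the earliest.\<close>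
      proof (rule pr_indep[where t = "(X + D) div 12"])
        fix f g :: "nat \<Rightarrow> nat"
        assume *: "\<forall>i<(X + D) div 12. f i = g i" "\<forall>i<100. \<not> hit f a (100 * X + i * D)"
        show "\<forall>i<100. \<not> hit g a (100 * X + i * D)"
        proof (intro allI impI)
          fix i :: nat assume "i < 100"
          then have "(i + 1) * D \<le> 100 * D" by (intro mult_le_mono1) simp
          then have "i * D + D \<le> 100 * D" by (simp only: distrib_right mult_1)
          then have "100 * X + i * D + 2400 \<le> 100 * X + 100 * D" using Suc.prems by linarith
          then have "(100 * X + i * D + 2400) div 1200 \<le> (100 * X + 100 * D) div 1200" by (rule div_le_mono)
          then have "(100 * X + i * D) div 1200 + 2 \<le> (X + D) div 12" unfolding X by simp
          then show "\<not> hit g a (100 * X + i * D)"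
            using * \<open>i < 100\<close> hit_cong[of f "100 * X + i * D" g a] by auto
        qed
      next
        fix f g :: "nat \<Rightarrow> nat"
        assume *: "\<forall>i\<ge>(X + D) div 12. f i = g i" "avoids f a q n (m - u) (X + D + j) (D + u)"
        have "(X + D) div 12 \<le> (X + D + j) div 12" by (rule div_le_mono) simp
        then show "avoids g a q n (m - u) (X + D + j) (D + u)"
          using * avoids_cong[of "X + D + j" f g] by auto
      qed
      also have "\<dots> \<le> (35 / 36) ^ 100 * (32 ^ (m - u) / 2 ^ n)"
        using 3 X Suc.prems assms by (intro mult_mono pr_no_hits IH pr_nonneg) auto
      also have "\<dots> \<le> 1 / 8 * (32 ^ (m - u) / 2 ^ n)"
      proof (rule mult_right_mono)
        show "(35 / 36) ^ 100 \<le> (1 / 8 :: real)" by (simp add: power_divide)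
      qed simp
      finally show ?thesis using 3 by simp
    qed
  qed
  have "?pr (\<lambda>f. avoids f a q (Suc n) m X D) \<le> (\<Sum>u\<in>{..m}. \<Sum>j\<in>{..u + 1}.
      ?pr (\<lambda>f. X + D + j \<le> q \<and> (u = 0 \<longrightarrow> (\<forall>i<100. \<not> hit f a (100 * X + i * D)))
      \<and> avoids f a q n (m - u) (X + D + j) (D + u)))"
    unfolding avoids.simps by (intro order.trans[OF pr_UN] sum_mono pr_UN) auto
  also have "\<dots> \<le> (\<Sum>u\<in>{..m}. \<Sum>j\<in>{..u + 1}. (if u = 0 then 1 / 8 else 1) * (32 ^ (m - u) / 2 ^ n))"
    by (intro sum_mono summand)
  also have "\<dots> = (\<Sum>u\<in>{..m}. (real (u + 2) * (if u = 0 then 1 / 8 else 1) * 32 ^ (m - u)) / 2 ^ n)"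
    by (intro sum.cong) auto
  also have "\<dots> \<le> (\<Sum>u\<in>{..m}. (32 ^ m / 4 * (1 / 2) ^ u) / 2 ^ n)"
    by (intro sum_mono divide_right_mono weight_le) auto
  also have "\<dots> = 32 ^ m / 4 / 2 ^ n * (\<Sum>u\<in>{..m}. (1 / 2) ^ u)"
    by (simp add: sum_distrib_left sum_divide_distrib)
  also have "\<dots> \<le> 32 ^ m / 4 / 2 ^ n * 2"
  proof (rule mult_left_mono)
    show "(\<Sum>u\<in>{..m}. (1 / 2) ^ u) \<le> (2::real)"
      by (subst sum_gp0) (auto simp: field_simps)
  qed simp
  also have "\<dots> = 32 ^ m / 2 ^ Suc n" by simp
  finally show ?case .
qed

section \<open>The union bound\<close>

text \<open>With \<open>8 * M\<close> segments and growth budget \<open>M\<close>, each start has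
  probability at most \<open>32 ^ M / 2 ^ (8 * M)\<close>, that is 8^(-M), while the starts
  \<open>a\<close>, \<open>X\<close>, \<open>D\<close> are polynomially many.\<close>

definition wave_free :: "nat \<Rightarrow> (nat \<Rightarrow> nat) \<Rightarrow> bool" where
  "wave_free M f \<longleftrightarrow> (\<forall>a<3. \<forall>X\<le>8 * M\<^sup>2. \<forall>D\<in>{2400..M}. \<not> avoids f a (8 * M\<^sup>2) (8 * M) M X D)"

lemma eventually_wave_free: "\<forall>\<^sub>F M in sequentially. \<exists>f. wave_free M f"
proof -
  have "\<forall>\<^sub>F M in sequentially. 3 * (8 * (real M)\<^sup>2 + 1) * (real M + 1) < 8 ^ M"
    by real_asymp
  then show ?thesis
  proof eventually_elim
    case (elim M)
    let ?q = "8 * M\<^sup>2"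
    let ?I = "{..<3::nat} \<times> {..?q} \<times> {2400..M}"
    let ?bad = "\<lambda>(a, X, D) f. avoids f a ?q (8 * M) M X D"
    show ?case
    proof (rule ccontr)
      assume none: "\<nexists>f. wave_free M f"
      have "1 = pr (?q + 2) (\<lambda>_. True)" using card_rotations_pos[of "?q + 2"] by (simp add: pr_def)
      also have "\<dots> \<le> pr (?q + 2) (\<lambda>f. \<exists>i\<in>?I. ?bad i f)"
        using none by (intro pr_mono) (fastforce simp: wave_free_def)
      also have "\<dots> \<le> (\<Sum>i\<in>?I. pr (?q + 2) (?bad i))" by (rule pr_UN) simp
      also have "\<dots> \<le> (\<Sum>i\<in>?I. 32 ^ M / 2 ^ (8 * M))"
      proof (rule sum_mono)
        fix i assume "i \<in> ?I"
        then obtain a X D where "i = (a, X, D)" "a < 3" "2400 \<le> D" by auto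
        then show "pr (?q + 2) (?bad i) \<le> 32 ^ M / 2 ^ (8 * M)" using pr_avoids[of a D ?q "8 * M" M X] by simp
      qed
      also have "\<dots> = real (card ?I) * (32 ^ M / 2 ^ (8 * M))" by simp
      also have "(32::real) ^ M / 2 ^ (8 * M) = 1 / 8 ^ M"
        unfolding power_mult power_divide[symmetric] by (simp add: power_divide)
      also have "real (card ?I) * (1 / 8 ^ M) \<le> (3 * (8 * (real M)\<^sup>2 + 1) * (real M + 1)) * (1 / 8 ^ M)"
      proof (rule mult_right_mono)
        have "card ?I \<le> 3 * ((8 * M\<^sup>2 + 1) * (M + 1))"
          unfolding card_cartesian_product by (intro mult_le_mono) auto
        then have "real (card ?I) \<le> real (3 * ((8 * M\<^sup>2 + 1) * (M + 1)))" by (rule of_nat_mono)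
        then show "real (card ?I) \<le> 3 * (8 * (real M)\<^sup>2 + 1) * (real M + 1)" by (simp add: algebra_simps)
      qed simp
      also have "\<dots> < 1" using elim by (simp add: field_simps)
      finally show False by simp
    qed
  qed
qed

section \<open>The lower bound\<close>

text \<open>Convexity is stated with sums to avoid truncated subtraction.\<close>

definition convex_seq :: "(nat \<Rightarrow> nat) \<Rightarrow> nat \<Rightarrow> bool" where
  "convex_seq x k \<longleftrightarrow> (\<forall>i. i + 1 < k \<longrightarrow> x i < x (i + 1)) \<and>
     (\<forall>i. i + 2 < k \<longrightarrow> x (i + 1) + x (i + 1) \<le> x (i + 2) + x i)"

lemma convex_seq_shift: "convex_seq x k \<Longrightarrow> l + s \<le> k \<Longrightarrow> convex_seq (\<lambda>i. x (i + s)) l"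
  unfolding convex_seq_def by (auto simp: algebra_simps dest: spec[of _ "_ + s"])

lemma convex_seq_diff_mono1:
  assumes "convex_seq x k" "i \<le> j" "j + 1 < k"
  shows "x (i + 1) + x j \<le> x (j + 1) + x i"
  using assms(2,3)
proof (induction j rule: dec_induct)
  case (step j)
  have "x (j + 1) + x (j + 1) \<le> x (j + 2) + x j" using assms(1) step by (simp add: convex_seq_def)
  then show ?case using step by simp
qed simp

lemma convex_seq_diff_mono:
  assumes "convex_seq x k" "i \<le> j" "j + q < k"
  shows "x (i + q) + x j \<le> x (j + q) + x i"
  using assms(3)
proof (induction q)
  case (Suc q)
  have "x (i + q + 1) + x (j + q) \<le> x (j + q + 1) + x (i + q)"
    using assms Suc by (intro convex_seq_diff_mono1[OF assms(1)]) auto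
  then show ?case using Suc by simp
qed simp

lemma convex_seq_growth: "convex_seq x k \<Longrightarrow> i + n < k \<Longrightarrow> x i + n \<le> x (i + n)"
proof (induction n)
  case (Suc n)
  have "x (i + n) < x (i + n + 1)" using Suc.prems by (simp add: convex_seq_def)
  then show ?case using Suc by simp
qed simp

lemma convex_seq_mono: "convex_seq x k \<Longrightarrow> i \<le> j \<Longrightarrow> j < k \<Longrightarrow> x i \<le> x j"
  using convex_seq_growth[of x k i "j - i"] by simp

lemma convex_seq_subsample:
  assumes "convex_seq x k" "\<And>i. i < n \<Longrightarrow> q * i < k" "0 < q"
  shows "convex_seq (\<lambda>i. x (q * i)) n"
  unfolding convex_seq_def
proof (intro conjI allI impI)
  fix i assume "i + 1 < n"
  then have "q * (i + 1) < k" using assms(2) by blast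
  then show "x (q * i) < x (q * (i + 1))"
    using convex_seq_growth[OF assms(1), of "q * i" q] assms(3) by (simp add: algebra_simps)
next
  fix i assume "i + 2 < n"
  then have "q * (i + 2) < k" using assms(2) by blast
  then show "x (q * (i + 1)) + x (q * (i + 1)) \<le> x (q * (i + 2)) + x (q * i)"
    using convex_seq_diff_mono[OF assms(1), of "q * i" "q * i + q" q] by (simp add: algebra_simps)
qed

lemma convex_seq_ge_tangent:
  assumes "convex_seq x k" "s + i < k" "s + 1 < k"
  shows "x s + i * (x (s + 1) - x s) \<le> x (s + i)"
  using assms(2)
proof (induction i)
  case (Suc i)
  have "x (s + 1) + x (s + i) \<le> x (s + i + 1) + x s"
    using Suc by (intro convex_seq_diff_mono1[OF assms(1)]) auto
  moreover have "x s < x (s + 1)" using assms by (simp add: convex_seq_def)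
  ultimately show ?case using Suc by simp
qed simp

lemma convex_seq_le_tangent:
  assumes "convex_seq x k" "s + i \<le> t" "t + 1 < k"
  shows "x (s + i) \<le> x s + i * (x (t + 1) - x t)"
  using assms(2)
proof (induction i)
  case (Suc i)
  have "x (s + i + 1) + x t \<le> x (t + 1) + x (s + i)"
    using Suc assms by (intro convex_seq_diff_mono1[OF assms(1)]) auto
  moreover have "x t < x (t + 1)" using assms by (simp add: convex_seq_def)
  ultimately show ?case using Suc by simp
qed simp

section \<open>Waves with differences above the block length\<close>

text \<open>All differences within a segment lie between its first difference and that of the next
  segment. This determines the terms up to growth and rounding, as \<open>avoids\<close>
  records.\<close>

lemma avoids_convex_seq:
  fixes z :: "nat \<Rightarrow> nat" and h :: nat
  defines "X \<equiv> \<lambda>s. z (100 * s) div (100 * h)" and "D \<equiv> \<lambda>s. (z (100 * s + 1) - z (100 * s)) div h"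
  assumes z: "convex_seq z N" and h: "0 < h" and avoid: "\<And>i. i < N \<Longrightarrow> symb f (z i div (200 * h)) \<noteq> a"
  shows "100 * (s + n) + 1 < N \<Longrightarrow> D (s + n) \<le> D s + m \<Longrightarrow> X (s + n) \<le> q \<Longrightarrow> avoids f a q n m (X s) (D s)"
proof (induction n arbitrary: s m)
  case (Suc n)
  have N: "100 * s + 101 < N" using Suc.prems by simp
  have Dmono: "D i \<le> D j" if "i \<le> j" "100 * j + 1 < N" for i j
    unfolding D_def using convex_seq_diff_mono1[OF z, of "100 * i" "100 * j"] that
    by (intro div_le_mono) simp
  have Xmono: "X i \<le> X j" if "i \<le> j" "100 * j < N" for i j
    unfolding X_def using convex_seq_mono[OF z, of "100 * i" "100 * j"] that
    by (intro div_le_mono) simp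
  define u where "u = D (s + 1) - D s"
  have Du: "D (s + 1) = D s + u" using Dmono[of s "s + 1"] N by (simp add: u_def)
  have Dn: "D (s + 1) \<le> D (s + Suc n)" using Suc.prems by (intro Dmono) auto
  have um: "u \<le> m" using Dn Du Suc.prems by simp
  have Xn: "X (s + 1) \<le> q" using Xmono[of "s + 1" "s + Suc n"] Suc.prems by simp
  let ?z = "z (100 * s)"
  let ?d = "z (100 * s + 1) - ?z"
  let ?d' = "z (100 * s + 101) - z (100 * s + 100)"
  have D': "D (s + 1) = ?d' div h" by (simp add: D_def algebra_simps)
  have zX: "100 * h * X s \<le> ?z" "?z < 100 * h * X s + 100 * h"
    unfolding X_def using h dividend_less_times_div[of "100 * h" ?z] by (simp_all add: add.commute)
  have dD: "h * D s \<le> ?d" unfolding D_def by simp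
  have dD': "?d' < h * (D s + u) + h" unfolding Du[symmetric] D' using h dividend_less_times_div[of h ?d'] by (simp add: add.commute)
  have low: "h * (100 * X s + i * D s) \<le> z (100 * s + i)" if "i \<le> 100" for i
  proof -
    have "h * (100 * X s + i * D s) = 100 * h * X s + i * (h * D s)" by (simp add: algebra_simps)
    also have "\<dots> \<le> ?z + i * ?d" using zX dD by (intro add_mono mult_le_mono) auto
    also have "\<dots> \<le> z (100 * s + i)" using that N by (intro convex_seq_ge_tangent[OF z]) auto
    finally show ?thesis .
  qed
  have up: "z (100 * s + i) < h * (100 * X s + i * (D s + u) + 100 + i)" if "i \<le> 100" for i
  proof -
    have "z (100 * s + i) \<le> ?z + i * ?d'"
      using convex_seq_le_tangent[OF z, of "100 * s" i "100 * s + 100"] that N by (simp add: algebra_simps)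
    also have "\<dots> < (100 * h * X s + 100 * h) + i * (h * (D s + u) + h)"
      using zX dD' by (intro add_less_le_mono mult_le_mono) auto
    also have "\<dots> = h * (100 * X s + i * (D s + u) + 100 + i)" by (simp add: algebra_simps)
    finally show ?thesis .
  qed
  have X': "X (s + 1) = z (100 * s + 100) div h div 100" unfolding X_def
    by (simp add: algebra_simps div_mult2_eq[symmetric])
  have "100 * (X s + D s) \<le> z (100 * s + 100) div h"
    using low[of 100] h by (simp add: less_eq_div_iff_mult_less_eq algebra_simps)
  then have X1: "X s + D s \<le> X (s + 1)" unfolding X' by simp
  have "z (100 * s + 100) div h < 100 * (X s + D s + u + 2)"
    using up[of 100] h by (simp add: div_less_iff_less_mult algebra_simps)
  then have X2: "X (s + 1) < X s + D s + u + 2" unfolding X' by simp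
  \<comment> \<open>The bounds \<open>low\<close> and \<open>up\<close> at the end of the segment
    confine the rounding error to at most \<open>u + 1\<close>.\<close>
  define j where "j = X (s + 1) - (X s + D s)"
  have j: "X s + D s + j = X (s + 1)" "j \<le> u + 1" using X1 X2 by (auto simp: j_def)
  have hits: "\<not> hit f a (100 * X s + i * D s)" if "u = 0" "i < 100" for i
  proof -
    let ?v = "100 * X s + i * D s"
    have "?v \<le> z (100 * s + i) div h" using low[of i] that h by (simp add: less_eq_div_iff_mult_less_eq mult.commute)
    then have 1: "?v div 200 \<le> z (100 * s + i) div h div 200" by (rule div_le_mono)
    \<comment> \<open>For \<open>u = 0\<close> and \<open>i < 100\<close>, \<open>up\<close> places
      the term less than 200 units beyond \<open>?v\<close>.\<close>
    have "z (100 * s + i) < h * (?v + 200)"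
      by (rule order.strict_trans1[OF _ order.strict_trans2[OF up[of i]]]) (use that in \<open>auto intro: mult_le_mono2\<close>)
    then have "z (100 * s + i) div h < ?v + 200" using h by (simp add: div_less_iff_less_mult mult.commute)
    then have "z (100 * s + i) div h div 200 \<le> (?v + 200) div 200" by (intro div_le_mono) simp
    then have 2: "z (100 * s + i) div h div 200 \<le> ?v div 200 + 1" by simp
    have "symb f (z (100 * s + i) div h div 200) \<noteq> a"
      using avoid[of "100 * s + i"] that N by (simp add: div_mult2_eq[symmetric] mult.commute)
    moreover have "z (100 * s + i) div h div 200 = ?v div 200 \<or> z (100 * s + i) div h div 200 = ?v div 200 + 1"
      using 1 2 by linarith
    ultimately show ?thesis by (auto simp: hit_def)
  qed
  have "avoids f a q n (m - u) (X (s + 1)) (D (s + 1))"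
    using Suc.prems Du um by (intro Suc.IH) auto
  then show ?case unfolding avoids.simps
    by (intro bexI[of _ u] bexI[of _ j] conjI) (use j hits um Xn Du in auto)
qed simp

text \<open>Sampling every 12th term turns differences above \<open>200 * h\<close> into differences
  of at least \<open>2400 * h\<close>, as independence requires. Of the \<open>1600 * M\<close>
  sampled steps, the first half supplies the \<open>8 * M\<close> segments, and the second half
  forces the difference in the middle below \<open>M * h\<close>.\<close>

lemma no_coarse_wave:
  assumes f: "wave_free M f" and M: "1 \<le> M" and h: "0 < h" and a: "a < 3"
    and x: "convex_seq x (20000 * M)" and jump: "x 0 + 200 * h < x 1"
    and bounded: "\<And>i. i < 20000 * M \<Longrightarrow> x i < 800 * M\<^sup>2 * h"
    and avoid: "\<And>i. i < 20000 * M \<Longrightarrow> symb f (x i div (200 * h)) \<noteq> a"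
  shows False
proof -
  define z where "z i = x (12 * i)" for i
  have idx: "12 * i < 20000 * M" if "i < 1600 * M + 1" for i using that M by linarith
  have z: "convex_seq z (1600 * M + 1)" unfolding z_def
    by (rule convex_seq_subsample[OF x idx]) auto
  have zb: "z i < 800 * M\<^sup>2 * h" if "i < 1600 * M + 1" for i
    unfolding z_def using bounded idx that by blast
  let ?X = "\<lambda>s. z (100 * s) div (100 * h)" and ?D = "\<lambda>s. (z (100 * s + 1) - z (100 * s)) div h"
  have X: "?X s \<le> 8 * M\<^sup>2" if "s \<le> 8 * M" for s
  proof -
    have "z (100 * s) < 800 * M\<^sup>2 * h" using that M by (intro zb) simp
    also have "\<dots> = (8 * M\<^sup>2) * (100 * h)" by simp
    finally show ?thesis using h by (simp add: div_less_iff_less_mult less_imp_le)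
  qed
  let ?d = "z (800 * M + 1) - z (800 * M)"
  have "z (800 * M) + 800 * M * ?d \<le> z (800 * M + 800 * M)"
    using M by (intro convex_seq_ge_tangent[OF z]) auto
  also have "\<dots> < 800 * M\<^sup>2 * h" by (rule zb) simp
  finally have "800 * M * ?d < 800 * M\<^sup>2 * h" by (rule le_less_trans[OF le_add2])
  also have "\<dots> = 800 * M * (M * h)" by (simp add: power2_eq_square)
  finally have "800 * M * ?d < 800 * M * (M * h)" .
  then have "?d < M * h" by simp
  then have DM: "?D (8 * M) < M" using h by (simp add: div_less_iff_less_mult)
  have "z 1 + z (800 * M) \<le> z (800 * M + 1) + z 0"
    using convex_seq_diff_mono1[OF z, of 0 "800 * M"] M by simp
  then have "?D 0 \<le> ?D (8 * M)" by (intro div_le_mono) simp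
  then have D0: "?D 0 \<le> M" using DM by simp
  have "x 0 + 12 * (x 1 - x 0) \<le> x 12" using convex_seq_ge_tangent[OF x, of 0 12] M by simp
  then have "2400 * h \<le> z 1 - z 0" using jump by (simp add: z_def)
  then have D0': "2400 \<le> ?D 0" using h by (simp add: less_eq_div_iff_mult_less_eq)
  have "avoids f a (8 * M\<^sup>2) (8 * M) M (?X 0) (?D 0)"
    by (rule avoids_convex_seq[OF z h])
      (use avoid idx DM X[of "8 * M"] M in \<open>auto simp: z_def\<close>)
  moreover have "\<not> avoids f a (8 * M\<^sup>2) (8 * M) M (?X 0) (?D 0)"
    using f a X[of 0] D0 D0' unfolding wave_free_def by simp
  ultimately show False by blast
qed

text \<open>Getting past the group of blocks that follows the first term means jumping over a block with
  symbol a, so from then on all differences exceed the block length.\<close>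

lemma no_wave_past_group:
  assumes f: "wave_free M f" and M: "1 \<le> M" and h: "0 < h" and a: "a < 3" and p: "0 < p"
    and x: "convex_seq x (p + 20000 * M)" and far: "x 0 + 2400 * h \<le> x p"
    and bounded: "\<And>i. i < p + 20000 * M \<Longrightarrow> x i < 800 * M\<^sup>2 * h"
    and avoid: "\<And>i. i < p + 20000 * M \<Longrightarrow> symb f (x i div (200 * h)) \<noteq> a"
  shows False
proof -
  let ?b = "200 * h"
  let ?g = "x 0 div ?b div 6 + 1"
  obtain y where y: "6 * ?g \<le> y" "y < 6 * ?g + 6" "symb f y = a" using symb_in_group[OF a] by blast
  have b: "0 < ?b" using h by simp
  have g: "w + 1 \<le> 6 * (w div 6 + 1)" "6 * (w div 6 + 1) \<le> w + 6" for w :: nat by presburger+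
  have "x 0 div ?b + 1 \<le> 6 * ?g" by (rule g)
  then have "(x 0 div ?b + 1) * ?b \<le> y * ?b" using y by (intro mult_le_mono1) linarith
  moreover have "x 0 < (x 0 div ?b + 1) * ?b"
    using dividend_less_div_times[OF b, of "x 0"] by (simp add: algebra_simps)
  ultimately have y0: "x 0 < y * ?b" by linarith
  \<comment> \<open>\<open>2400 * h\<close> is twelve blocks, enough to pass every block of the
    group after that of \<open>x 0\<close>.\<close>
  have "y + 1 \<le> x 0 div ?b + 12" using y g(2)[of "x 0 div ?b"] by linarith
  then have "(y + 1) * ?b \<le> (x 0 div ?b + 12) * ?b" by (intro mult_le_mono1)
  also have "\<dots> = x 0 div ?b * ?b + 2400 * h" by (simp add: algebra_simps)
  also have "\<dots> \<le> x p" using far div_times_less_eq_dividend[of "x 0" ?b] by linarith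
  finally have yp: "(y + 1) * ?b \<le> x p" .
  define i where "i = (LEAST i. y * ?b \<le> x i)"
  have "y * ?b \<le> x p" using yp by simp
  then have i: "y * ?b \<le> x i" "i \<le> p" unfolding i_def by (auto intro: LeastI Least_le)
  have "i \<noteq> 0" using i(1) y0 by (metis leD)
  then obtain i' where i': "i = Suc i'" by (cases i) auto
  have less: "x i' < y * ?b"
    using not_less_Least[of i' "\<lambda>i. y * ?b \<le> x i"] i' unfolding i_def by simp
  \<comment> \<open>The first term at or after the start of block \<open>y\<close> must lie past its
    end, so one difference exceeds a block length.\<close>
  have "x i div ?b \<noteq> y" using avoid[of i] y(3) i(2) M by auto
  moreover have "y \<le> x i div ?b" using i(1) b by (simp add: less_eq_div_iff_mult_less_eq)
  ultimately have "y + 1 \<le> x i div ?b" by linarith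
  then have "(y + 1) * ?b \<le> x i" using b by (simp only: less_eq_div_iff_mult_less_eq)
  then have jump: "x i' + ?b < x (i' + 1)" using less i' by simp
  \<comment> \<open>Convexity carries the long jump on to the step ending at \<open>p\<close>,
    wherever the crossing took place.\<close>
  have "x (i' + 1) + x (p - 1) \<le> x (p - 1 + 1) + x i'"
    using i(2) i' p M by (intro convex_seq_diff_mono1[OF x]) auto
  then have pj: "x (p - 1) + ?b < x p" using jump p by simp
  have "convex_seq (\<lambda>i. x (i + (p - 1))) (20000 * M)" using p by (intro convex_seq_shift[OF x]) auto
  from no_coarse_wave[OF f M h a this] show False
    using p pj bounded avoid by auto
qed

section \<open>The two-scale colouring\<close>

text \<open>The outer symbol is the omitted colour. The inner symbol 0 selects the next colour
  modulo 3, the inner symbols 1 and 2 the one after it. With inner unit \<open>h = M\<close>, an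
  outer block is exactly the range \<open>800 * M^2 * h\<close> that \<open>no_coarse_wave\<close>
  handles.\<close>

definition colouring :: "nat \<Rightarrow> (nat \<Rightarrow> nat) \<Rightarrow> nat \<Rightarrow> nat" where
  "colouring M f x = (symb f (x div (800 * M ^ 3)) +
     (if symb f (x mod (800 * M ^ 3) div (200 * M)) = 0 then 1 else 2)) mod 3"

lemma colouring_less: "colouring M f x < 3"
  by (simp add: colouring_def)

lemma colouring_outer: "symb f (x div (800 * M ^ 3)) \<noteq> colouring M f x"
  using symb_less[of f "x div (800 * M ^ 3)"] unfolding colouring_def
  by (auto split: if_splits) presburger+

text \<open>Differences are at least 1, so \<open>2400 * M\<close> terms pass two groups of inner
  blocks; the other \<open>20000 * M\<close> terms form the coarse wave.\<close>

lemma no_wave_in_block: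
  assumes f: "wave_free M f" and M: "1 \<le> M" and x: "convex_seq x (22400 * M)"
    and col: "\<And>i. i < 22400 * M \<Longrightarrow> colouring M f (x i) = a"
    and block: "\<And>i. i < 22400 * M \<Longrightarrow> x i div (800 * M ^ 3) = J"
  shows False
proof -
  let ?B = "800 * M ^ 3"
  define y where "y i = x i mod ?B" for i
  have xy: "x i = J * ?B + y i" if "i < 22400 * M" for i
    using block[OF that] div_mult_mod_eq[of "x i" ?B] by (simp add: y_def)
  have y: "convex_seq y (22400 * M)"
    unfolding convex_seq_def
  proof (intro conjI allI impI)
    fix i assume i: "i + 1 < 22400 * M"
    then have "x i < x (i + 1)" using x unfolding convex_seq_def by blast
    then show "y i < y (i + 1)" using i xy[of i] xy[of "i + 1"] by simp
  next
    fix i assume i: "i + 2 < 22400 * M"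
    then have "x (i + 1) + x (i + 1) \<le> x (i + 2) + x i" using x unfolding convex_seq_def by blast
    then show "y (i + 1) + y (i + 1) \<le> y (i + 2) + y i"
      using i xy[of i] xy[of "i + 1"] xy[of "i + 2"] by simp
  qed
  \<comment> \<open>One of the two available colours occurs only on inner symbol 0 and so avoids 1;
    the other avoids 0.\<close>
  define s where "s = (if a = (symb f J + 1) mod 3 then 1 else 0 :: nat)"
  have s: "symb f (y i div (200 * M)) \<noteq> s" if "i < 22400 * M" for i
  proof -
    have "a = (symb f J + (if symb f (y i div (200 * M)) = 0 then 1 else 2)) mod 3"
      using col[OF that] block[OF that] by (simp add: colouring_def y_def)
    moreover have "(symb f J + 1) mod 3 \<noteq> (symb f J + 2) mod 3" by presburger
    ultimately show ?thesis unfolding s_def by (auto split: if_splits)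
  qed
  have "y i < 800 * M\<^sup>2 * M" for i
  proof -
    have "y i < ?B" using M by (simp add: y_def)
    then show ?thesis by (simp add: power2_eq_square power3_eq_cube)
  qed
  moreover have "y 0 + 2400 * M \<le> y (2400 * M)" using convex_seq_growth[OF y, of 0 "2400 * M"] M by simp
  ultimately show False
    using s y M by (intro no_wave_past_group[OF f M, of M s "2400 * M" y]) (auto simp: s_def)
qed

text \<open>\<open>311200 * M\<close> is \<open>13 * 22400 * M + 20000 * M\<close>. Each of thirteen
  stretches leaves an outer block, so together they cover twelve full blocks, and the argument is
  repeated with \<open>h = 4 * M ^ 3\<close>.\<close>

lemma no_wave:
  assumes f: "wave_free M f" and M: "1 \<le> M" and x: "convex_seq x (311200 * M)"
    and bounded: "\<And>i. i < 311200 * M \<Longrightarrow> x i < 3200 * M ^ 5"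
    and col: "\<And>i. i < 311200 * M \<Longrightarrow> colouring M f (x i) = a"
  shows False
proof -
  let ?B = "800 * M ^ 3" and ?R = "22400 * M"
  have step: "x i div ?B + 1 \<le> x (i + ?R) div ?B" if "i + ?R < 311200 * M" for i
  proof (rule ccontr)
    assume neg: "\<not> ?thesis"
    have eq: "x (l + i) div ?B = x i div ?B" if l: "l < ?R" for l
    proof (rule antisym)
      have "x (l + i) div ?B \<le> x (i + ?R) div ?B"
        using l \<open>i + ?R < 311200 * M\<close> by (intro div_le_mono convex_seq_mono[OF x]) auto
      then show "x (l + i) div ?B \<le> x i div ?B" using neg by linarith
      show "x i div ?B \<le> x (l + i) div ?B"
        using l \<open>i + ?R < 311200 * M\<close> by (intro div_le_mono convex_seq_mono[OF x]) auto
    qed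
    show False
      by (rule no_wave_in_block[OF f M, of "\<lambda>l. x (l + i)" a "x i div ?B"])
        (use eq col that in \<open>auto intro!: convex_seq_shift[OF x]\<close>)
  qed
  have blocks: "x 0 div ?B + l \<le> x (l * ?R) div ?B" if "l \<le> 13" for l
    using that
  proof (induction l)
    case (Suc l)
    have "l * ?R + ?R \<le> 13 * ?R" using Suc.prems by simp
    then have "x (l * ?R) div ?B + 1 \<le> x (l * ?R + ?R) div ?B" using M by (intro step) linarith
    then show ?case using Suc by (simp add: algebra_simps)
  qed simp
  have "(x 0 div ?B + 13) * ?B \<le> x (13 * ?R)"
    using blocks[of 13] M by (simp add: less_eq_div_iff_mult_less_eq)
  moreover have "x 0 < (x 0 div ?B + 1) * ?B"
    using dividend_less_div_times[of ?B "x 0"] M by (simp add: algebra_simps)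
  ultimately have far: "x 0 + 2400 * (4 * M ^ 3) \<le> x (13 * ?R)" by (simp add: algebra_simps)
  have B: "800 * M\<^sup>2 * (4 * M ^ 3) = 3200 * M ^ 5" by (simp add: power_add[symmetric])
  have a: "a < 3" using col[of 0] M colouring_less[of M f "x 0"] by simp
  have "symb f (x i div (200 * (4 * M ^ 3))) \<noteq> a" if "i < 311200 * M" for i
    using colouring_outer[of f "x i" M] col[OF that] by simp
  then show False
    by (intro no_wave_past_group[OF f M _ a, of "4 * M ^ 3" "13 * ?R" x])
      (use M far x bounded B in auto)
qed

lemma ascending_wave_convex_seq: "ascending_wave w \<Longrightarrow> convex_seq (\<lambda>i. w ! i) (length w)"
proof -
  assume w: "ascending_wave w"
  have inc: "w ! i < w ! (i + 1)" if "i + 1 < length w" for i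
    using w that by (simp add: ascending_wave_def sorted_wrt_iff_nth_less)
  show ?thesis unfolding convex_seq_def
  proof (intro conjI allI impI inc)
    fix i assume i: "i + 2 < length w"
    then have "w ! (i + 1) - w ! i \<le> w ! (i + 2) - w ! (i + 1)"
      using w unfolding ascending_wave_def by (auto dest: spec[of _ "i + 1"])
    then show "w ! (i + 1) + w ! (i + 1) \<le> w ! (i + 2) + w ! i"
      using inc[of i] inc[of "i + 1"] i by simp
  qed
qed

lemma not_AW_prop:
  assumes f: "wave_free M f" and M: "1 \<le> M" and k: "311200 * M \<le> k" and N: "N < 3200 * M ^ 5"
  shows "\<not> AW_prop k 3 N"
proof
  assume "AW_prop k 3 N"
  then obtain w a where w: "length w = k" "ascending_wave w" "set w \<subseteq> {1..N}" "\<forall>x\<in>set w. colouring M f x = a"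
    unfolding AW_prop_def using colouring_less by metis
  have "convex_seq (\<lambda>i. w ! (i + 0)) (311200 * M)"
    by (rule convex_seq_shift[OF ascending_wave_convex_seq[OF w(2)]]) (use w k in simp)
  moreover have "w ! i < 3200 * M ^ 5" "colouring M f (w ! i) = a" if "i < 311200 * M" for i
  proof -
    have mem: "w ! i \<in> set w" using that w k by simp
    then have "w ! i \<le> N" using w(3) by auto
    then show "w ! i < 3200 * M ^ 5" "colouring M f (w ! i) = a" using N w(4) mem by auto
  qed
  ultimately show False using no_wave[OF f M, of "\<lambda>i. w ! i" a] by simp
qed

lemma AW_3_lower:
  "\<forall>\<^sub>F k in sequentially. real k ^ 5 / (2 ^ 13 * 10 ^ 39) \<le> real (AW k 3)"
proof -
  have "filterlim (\<lambda>k :: nat. k div 311200) sequentially sequentially"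
    by (rule filterlim_at_top_div_const_nat) simp
  from eventually_compose_filterlim[OF eventually_wave_free this]
  have "\<forall>\<^sub>F k in sequentially. \<exists>f. wave_free (k div 311200) f" .
  then show ?thesis using eventually_ge_at_top[of 311200]
  proof eventually_elim
    case (elim k)
    define M where "M = k div 311200"
    have M: "1 \<le> M" using elim(2) unfolding M_def by (simp add: less_eq_div_iff_mult_less_eq)
    obtain f where f: "wave_free M f" using elim(1) by (auto simp: M_def)
    have kM: "311200 * M \<le> k" by (simp add: M_def)
    have "AW_prop k 3 (AW k 3)" using AW_prop_AW[OF forces_waves_3] elim by simp
    then have AW: "3200 * M ^ 5 \<le> AW k 3" using not_AW_prop[OF f M kM, of "AW k 3"] by (metis not_le)
    have "k < 311200 * M + 311200" using dividend_less_times_div[of 311200 k] by (simp add: M_def)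
    \<comment> \<open>Rounding \<open>k\<close> down costs at most a factor 2, and the stated
      constant leaves a wide margin.\<close>
    then have "k \<le> 622400 * M" using M by linarith
    then have "k ^ 5 \<le> (622400 * M) ^ 5" by (rule power_mono) simp
    also have "\<dots> = 622400 ^ 5 * M ^ 5" by (rule power_mult_distrib)
    also have "\<dots> \<le> (2 ^ 13 * 10 ^ 39 * 3200) * M ^ 5" by (rule mult_right_mono) auto
    also have "\<dots> \<le> (2 ^ 13 * 10 ^ 39) * AW k 3" using AW by simp
    finally have "real (k ^ 5) \<le> real ((2 ^ 13 * 10 ^ 39) * AW k 3)" by (rule of_nat_mono)
    then show ?case by (simp add: field_simps)
  qed
qed

theorem theorem3:
  shows "(\<forall>\<^sub>F k in sequentially. real k ^ 5 / (2 ^ 13 * 10 ^ 39) \<le> real (AW k 3)) \<and>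
         (\<exists>g :: nat \<Rightarrow> real. g \<longlonglongrightarrow> 0 \<and>
            (\<forall>\<^sub>F k in sequentially. real (AW k 3) \<le> real k ^ 5 / 120 * (1 + g k)))"
  using AW_3_lower AW_3_upper by blast

end
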